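(* Let $\{i,j\}=\{1,2\}$. Every compact $i$-prefit bilocale $(L,L_1,L_2)$ is $(i,j)$-Baire.
   Context: A locale is a complete lattice $L$ with $a\wedge\bigvee B=\bigvee\{a\wedge b:b\in B\}$ for all $a\in L$, $B\subseteq L$; $\to$ is its Heyting operation. A subframe of $L$ is a subset closed under all joins and finite meets. A bilocale is a triple $(L,L_1,L_2)$ with $L_1,L_2$ subframes of a locale $L$ such that $a=\bigvee\{a_1\wedge a_2:a_1\in L_1,a_2\in L_2,a_1\wedge a_2\le a\}$ for all $a\in L$. It is compact if the top element of $L$ is compact, i.e. $1=\bigvee A$ with $A\subseteq L$ implies $1=\bigvee F$ for some finite $F\subseteq A$. For $c\in L_i$ the bilocale pseudocomplement is $c^{\bullet}=\bigvee\{x\in L_j:x\wedge c=0\}$ ($j\neq i$). The bilocale is $i$-prefit if for every nonzero $x\in L$ there is a nonzero $y\in L_i$ with $y^{\bullet}\vee x=1$. A sublocale of $L$ is a subset $S$ closed under all meets with $x\to s\in S$ for all $x\in L$, $s\in S$. For $a\in L$, $\mathfrak o(a)=\{a\to x:x\in L\}$ is an open sublocale and $\mathfrak c(a)=\{x\in L:a\le x\}$ a closed sublocale. A sublocale is $j$-open if it equals $\mathfrak o(a)$ for some $a\in L_j$; a sublocale $S$ is $i$-dense if $\bigcap\{\mathfrak c(a):a\in L_i,\ S\subseteq\mathfrak c(a)\}=L$ (equivalently $S\cap\mathfrak o(x)\neq\{1\}$ for every nonzero $x\in L_i$). The bilocale is $(i,j)$-Baire if the intersection of any countably many $i$-dense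 $j$-open sublocales is $i$-dense. *)

theory Defs
  imports Main "HOL-Library.Countable_Set"
begin

(* The underlying locale is the whole type: HOL has no class for frames, its
   complete_distrib_lattice is strictly stronger. *)

class frame = complete_lattice +
  assumes inf_Sup_distrib: "inf a (Sup B) = Sup {inf a b | b. b \<in> B}"

definition heyting :: "'a::frame \<Rightarrow> 'a \<Rightarrow> 'a" (infixr "\<leadsto>" 60)
  where "a \<leadsto> b = Sup {x. inf x a \<le> b}"

(* Closure under the empty join and the empty meet puts bot and top in M. *)

definition subframe :: "'a::frame set \<Rightarrow> bool"
  where "subframe M \<longleftrightarrow>
    (\<forall>A. A \<subseteq> M \<longrightarrow> Sup A \<in> M) \<and>
    (\<forall>F. F \<subseteq> M \<and> finite F \<longrightarrow> Inf F \<in> M)"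

definition bilocale :: "'a::frame set \<Rightarrow> 'a set \<Rightarrow> bool"
  where "bilocale L1 L2 \<longleftrightarrow>
    subframe L1 \<and> subframe L2 \<and>
    (\<forall>a. a = Sup {inf a1 a2 | a1 a2. a1 \<in> L1 \<and> a2 \<in> L2 \<and> inf a1 a2 \<le> a})"

(* Compactness concerns the ambient locale only, so the argument is its type. *)

definition compact_locale :: "'a::frame itself \<Rightarrow> bool"
  where "compact_locale _ \<longleftrightarrow>
    (\<forall>A::'a set. Sup A = top \<longrightarrow> (\<exists>F. F \<subseteq> A \<and> finite F \<and> Sup F = top))"

(* Indices are the numbers 1 and 2; other arguments are never used. *)

definition component :: "'a set \<Rightarrow> 'a set \<Rightarrow> nat \<Rightarrow> 'a set"
  where "component L1 L2 i = (if i = 1 then L1 else L2)"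

(* The index i is an explicit argument because c may lie in both L1 and L2. *)

definition bipseudocomplement :: "'a::frame set \<Rightarrow> 'a set \<Rightarrow> nat \<Rightarrow> 'a \<Rightarrow> 'a"
  where "bipseudocomplement L1 L2 i c =
    Sup {x. \<exists>j\<in>{1, 2}. j \<noteq> i \<and> x \<in> component L1 L2 j \<and> inf x c = bot}"

definition prefit :: "'a::frame set \<Rightarrow> 'a set \<Rightarrow> nat \<Rightarrow> bool"
  where "prefit L1 L2 i \<longleftrightarrow>
    (\<forall>x. x \<noteq> bot \<longrightarrow>
      (\<exists>y\<in>component L1 L2 i. y \<noteq> bot \<and> sup (bipseudocomplement L1 L2 i y) x = top))"

definition is_sublocale :: "'a::frame set \<Rightarrow> bool"
  where "is_sublocale S \<longleftrightarrow>
    (\<forall>A. A \<subseteq> S \<longrightarrow> Inf A \<in> S) \<and> (\<forall>x. \<forall>s\<in>S. (x \<leadsto> s) \<in> S)"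

definition open_sublocale :: "'a::frame \<Rightarrow> 'a set"
  where "open_sublocale a = {a \<leadsto> x | x. True}"

definition closed_sublocale :: "'a::frame \<Rightarrow> 'a set"
  where "closed_sublocale a = {x. a \<le> x}"

definition bi_open :: "'a::frame set \<Rightarrow> 'a set \<Rightarrow> nat \<Rightarrow> 'a set \<Rightarrow> bool"
  where "bi_open L1 L2 j S \<longleftrightarrow>
    is_sublocale S \<and> (\<exists>a\<in>component L1 L2 j. S = open_sublocale a)"

definition bi_dense :: "'a::frame set \<Rightarrow> 'a set \<Rightarrow> nat \<Rightarrow> 'a set \<Rightarrow> bool"
  where "bi_dense L1 L2 i S \<longleftrightarrow>
    is_sublocale S \<and>
    \<Inter> {closed_sublocale a | a. a \<in> component L1 L2 i \<and> S \<subseteq> closed_sublocale a} = UNIV"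

(* Intersections are taken in the whole locale, so the empty family has
   intersection UNIV. *)

definition bi_Baire :: "'a::frame set \<Rightarrow> 'a set \<Rightarrow> nat \<Rightarrow> nat \<Rightarrow> bool"
  where "bi_Baire L1 L2 i j \<longleftrightarrow>
    (\<forall>\<S>. countable \<S> \<and> (\<forall>S\<in>\<S>. bi_dense L1 L2 i S \<and> bi_open L1 L2 j S)
      \<longrightarrow> bi_dense L1 L2 i (\<Inter> \<S>))"

lemma heyting_adjoint: "z \<le> (a \<leadsto> b) \<longleftrightarrow> inf z a \<le> b"
proof
  assume "z \<le> (a \<leadsto> b)"
  then have "inf z a \<le> inf a (a \<leadsto> b)"
    by (simp add: le_infI1)
  also have "\<dots> \<le> b"
    unfolding heyting_def inf_Sup_distrib by (rule Sup_least) (auto simp: inf_commute)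
  finally show "inf z a \<le> b" .
next
  assume "inf z a \<le> b"
  then show "z \<le> (a \<leadsto> b)"
    unfolding heyting_def by (auto intro: Sup_upper)
qed

(* The next two lemmas show that the sublocale conjuncts in bi_open and
   bi_dense exclude no set arising in bi_Baire. *)

lemma is_sublocale_open_sublocale: "is_sublocale (open_sublocale a)"
  unfolding is_sublocale_def
proof (intro conjI allI impI ballI)
  fix A assume A: "A \<subseteq> open_sublocale a"
  have fixed: "(a \<leadsto> s) = s" if "s \<in> A" for s
  proof -
    from that A obtain x where s: "s = (a \<leadsto> x)"
      unfolding open_sublocale_def by auto
    have "z \<le> (a \<leadsto> s) \<longleftrightarrow> z \<le> s" for z
      unfolding s by (simp add: heyting_adjoint inf.assoc)
    then show ?thesis
      by (meson order_antisym order.refl)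
  qed
  have "(a \<leadsto> Inf A) = Inf A"
  proof (rule order_antisym)
    show "(a \<leadsto> Inf A) \<le> Inf A"
    proof (rule Inf_greatest)
      fix s assume "s \<in> A"
      then have "(a \<leadsto> Inf A) \<le> (a \<leadsto> s)"
        using heyting_adjoint[of "a \<leadsto> Inf A" a "Inf A"]
        by (auto simp: heyting_adjoint intro: order_trans Inf_lower)
      then show "(a \<leadsto> Inf A) \<le> s"
        using fixed \<open>s \<in> A\<close> by simp
    qed
    show "Inf A \<le> (a \<leadsto> Inf A)"
      by (simp add: heyting_adjoint)
  qed
  then show "Inf A \<in> open_sublocale a"
    unfolding open_sublocale_def by (metis (mono_tags, lifting) mem_Collect_eq)
next
  fix x s assume "s \<in> open_sublocale a"
  then obtain y where s: "s = (a \<leadsto> y)"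
    unfolding open_sublocale_def by auto
  have "z \<le> (x \<leadsto> (a \<leadsto> y)) \<longleftrightarrow> z \<le> (a \<leadsto> (x \<leadsto> y))" for z
    by (simp add: heyting_adjoint inf.assoc inf.commute inf.left_commute)
  then have "(x \<leadsto> s) = (a \<leadsto> (x \<leadsto> y))"
    unfolding s by (meson order_antisym order.refl)
  then show "(x \<leadsto> s) \<in> open_sublocale a"
    unfolding open_sublocale_def by auto
qed

lemma is_sublocale_Inter: "(\<And>S. S \<in> \<S> \<Longrightarrow> is_sublocale S) \<Longrightarrow> is_sublocale (\<Inter> \<S>)"
  unfolding is_sublocale_def by blast

end

theory Submission
  imports Defs
begin

text \<open>
  Suppose some nonzero \<open>b \<in> L\<^sub>i\<close> lies below every element of \<open>\<Inter>\<^sub>n \<oo>(a\<^sub>n)\<close>. Put \<open>y\<^sub>0 = b\<close>; by density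
  \<open>y\<^sub>n \<and> a\<^sub>n \<noteq> 0\<close>, so prefitness gives a nonzero \<open>y\<^sub>n\<^sub>+\<^sub>1 \<in> L\<^sub>i\<close> whose pseudocomplement joins
  \<open>y\<^sub>n \<and> a\<^sub>n\<close> to the top. Then \<open>y\<close> decreases, so the pseudocomplements form a chain of
  elements different from the top, and by compactness their join \<open>p\<close> is not the top. But
  \<open>p \<or> a\<^sub>n = 1\<close> puts \<open>p\<close> into every \<open>\<oo>(a\<^sub>n)\<close>, hence \<open>b \<le> p\<close>, while also \<open>p \<or> b = 1\<close>.
\<close>

lemma inf_sup_distrib_frame: "inf a (sup b c) = sup (inf a b) (inf a (c::'a::frame))"
proof -
  have "inf a (Sup {b, c}) = Sup {inf a x | x. x \<in> {b, c}}"
    by (rule inf_Sup_distrib)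
  also have "{inf a x | x. x \<in> {b, c}} = {inf a b, inf a c}"
    by auto
  finally show ?thesis by simp
qed

text \<open>By distributivity \<open>x\<close> is the join of its meets with \<open>c\<close> and
  \<open>d\<close>, so an inequality can be checked on each part of a cover.\<close>

lemma le_of_sup_eq_top:
  fixes x :: "'a::frame"
  assumes "sup c d = top" "inf x c \<le> e" "inf x d \<le> e"
  shows "x \<le> e"
proof -
  have "x = sup (inf x c) (inf x d)"
    using assms(1) inf_sup_distrib_frame[of x c d] by simp
  also have "\<dots> \<le> e"
    using assms by simp
  finally show ?thesis .
qed

lemma inf_bipseudocomplement: "inf c (bipseudocomplement L1 L2 i c) = (bot::'a::frame)"
proof -
  have "inf c (bipseudocomplement L1 L2 i c) \<le> bot"
    unfolding bipseudocomplement_def inf_Sup_distrib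
    by (rule Sup_least) (auto simp: inf_commute)
  then show ?thesis by (simp add: bot_unique)
qed

lemma bipseudocomplement_antimono:
  fixes c d :: "'a::frame"
  assumes "c \<le> d"
  shows "bipseudocomplement L1 L2 i d \<le> bipseudocomplement L1 L2 i c"
proof -
  have "inf x c = bot" if "inf x d = bot" for x
    using inf_mono[OF order_refl[of x] assms] that by (simp add: bot_unique)
  then show ?thesis
    unfolding bipseudocomplement_def by (intro Sup_subset_mono) blast
qed

text \<open>The part of \<open>y\<close> inside its pseudocomplement is \<open>bot\<close>, so the
  rest of the cover contains all of \<open>y\<close>.\<close>

lemma le_of_sup_bipseudocomplement:
  fixes x y :: "'a::frame"
  assumes "sup (bipseudocomplement L1 L2 i y) x = top"
  shows "y \<le> x"
  using assms by (rule le_of_sup_eq_top) (simp_all add: inf_bipseudocomplement)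

text \<open>The least element of \<open>open_sublocale a\<close> is \<open>a \<leadsto> bot\<close>,
  so it alone decides the inclusion.\<close>

lemma open_sublocale_subset_closed:
  "open_sublocale a \<subseteq> closed_sublocale b \<longleftrightarrow> inf b a = (bot::'a::frame)"
proof
  assume "open_sublocale a \<subseteq> closed_sublocale b"
  then have "b \<le> (a \<leadsto> bot)"
    unfolding open_sublocale_def closed_sublocale_def by auto
  then show "inf b a = bot"
    by (simp add: heyting_adjoint bot_unique)
qed (auto simp: open_sublocale_def closed_sublocale_def heyting_adjoint)

text \<open>On each part of the cover by \<open>p\<close> and \<open>a\<close>, the element
  \<open>a \<leadsto> p\<close> is below \<open>p\<close>; hence \<open>p\<close> is a fixed point
  of \<open>a \<leadsto> _\<close>.\<close>

lemma mem_open_sublocale: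
  fixes p :: "'a::frame"
  assumes "sup p a = top"
  shows "p \<in> open_sublocale a"
proof -
  have "(a \<leadsto> p) \<le> p"
    by (rule le_of_sup_eq_top[OF assms]) (auto simp flip: heyting_adjoint)
  then have "p = (a \<leadsto> p)"
    by (intro antisym) (simp_all add: heyting_adjoint)
  then show ?thesis
    unfolding open_sublocale_def by blast
qed

lemma bi_dense_iff:
  "bi_dense L1 L2 i S \<longleftrightarrow> is_sublocale S \<and>
    (\<forall>a\<in>component L1 L2 i. S \<subseteq> closed_sublocale a \<longrightarrow> a = (bot::'a::frame))"
proof -
  have "closed_sublocale a = UNIV \<longleftrightarrow> a = bot" for a :: 'a
    unfolding closed_sublocale_def by (auto simp: set_eq_iff intro: bot_unique[THEN iffD1])
  then show ?thesis
    unfolding bi_dense_def by (auto simp: Inter_UNIV_conv)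
qed

lemma compact_locale_chain:
  fixes f :: "nat \<Rightarrow> 'a::frame"
  assumes "compact_locale TYPE('a)" "mono f" "Sup (range f) = top"
  obtains n where "f n = top"
proof -
  from assms obtain F where F: "F \<subseteq> range f" "finite F" "Sup F = top"
    unfolding compact_locale_def by blast
  then obtain N where N: "finite N" "F = f ` N"
    by (meson finite_subset_image)
  \<comment> \<open>The inserted 0 keeps \<open>Max\<close> meaningful when \<open>N\<close> is
    empty.\<close>
  have "Sup F \<le> f (Max (insert 0 N))"
    unfolding N using N(1) by (auto intro!: SUP_least monoD[OF assms(2)] simp: Max_ge)
  then show ?thesis
    using F that by (simp add: top_unique)
qed

lemma prefit_eq_bot:
  fixes L1 L2 :: "'a::frame set" and a :: "nat \<Rightarrow> 'a"
  assumes compact: "compact_locale TYPE('a)"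
    and prefit: "prefit L1 L2 i"
    and dense: "\<And>n x. x \<in> component L1 L2 i \<Longrightarrow> inf x (a n) = bot \<Longrightarrow> x = bot"
    and b: "b \<in> component L1 L2 i" "(\<Inter>n. open_sublocale (a n)) \<subseteq> closed_sublocale b"
  shows "b = bot"
proof (rule ccontr)
  assume "b \<noteq> bot"
  let ?pc = "bipseudocomplement L1 L2 i"
  have step: "\<exists>y'\<in>component L1 L2 i. y' \<noteq> bot \<and> sup (?pc y') (inf y (a n)) = top"
    if "y \<in> component L1 L2 i" "y \<noteq> bot" for y n
  proof -
    from that have "inf y (a n) \<noteq> bot"
      using dense by blast
    then show ?thesis
      using prefit unfolding prefit_def by blast
  qed
  \<comment> \<open>The clause for \<open>n = 0\<close> pins the start of the sequence at
    \<open>b\<close>.\<close>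
  obtain y where y: "\<And>n. y n \<in> component L1 L2 i \<and> y n \<noteq> bot \<and> (n = 0 \<longrightarrow> y n = b)"
    "\<And>n. sup (?pc (y (Suc n))) (inf (y n) (a n)) = top"
    using dependent_nat_choice[of
        "\<lambda>n y. y \<in> component L1 L2 i \<and> y \<noteq> bot \<and> (n = 0 \<longrightarrow> y = b)"
        "\<lambda>n y y'. sup (?pc y') (inf y (a n)) = top"]
      step b(1) \<open>b \<noteq> bot\<close> by blast
  define p where "p = (SUP n. ?pc (y n))"
  have pc_le: "?pc (y n) \<le> p" for n
    unfolding p_def by (rule SUP_upper) simp
  \<comment> \<open>Used with \<open>x = a n\<close> to place \<open>p\<close> in every open
    sublocale, and with \<open>x = b\<close> at \<open>n = 0\<close>, where
    \<open>y 0 = b\<close>.\<close>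
  have p_sup: "sup p x = top" if "inf (y n) (a n) \<le> x" for x n
    using sup_mono[OF pc_le[of "Suc n"] that] y(2)[of n] by (simp add: top_unique)
  have "p \<in> (\<Inter>n. open_sublocale (a n))"
    using p_sup[OF inf_le2] by (simp add: mem_open_sublocale)
  then have "b \<le> p"
    using b(2) unfolding closed_sublocale_def by auto
  moreover have "sup p b = top"
    using y(1)[of 0] by (intro p_sup[of 0]) simp
  ultimately have "Sup (range (\<lambda>n. ?pc (y n))) = top"
    by (simp add: p_def sup_absorb1)
  \<comment> \<open>The cover gives \<open>y (Suc n) \<le> inf (y n) (a n) \<le> y n\<close>, and
    pseudocomplementation reverses order.\<close>
  moreover have "mono (\<lambda>n. ?pc (y n))"
    unfolding mono_iff_le_Suc
    using le_of_sup_bipseudocomplement[OF y(2)] by (auto intro: bipseudocomplement_antimono)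
  ultimately obtain n where "?pc (y n) = top"
    using compact_locale_chain[OF compact] by blast
  then have "y n = bot"
    using inf_bipseudocomplement[of "y n" L1 L2 i] by simp
  then show False
    using y(1) by blast
qed

theorem proposition2p10:
  fixes L1 L2 :: "'a::frame set" and i j :: nat
  assumes "{i, j} = {1, 2}"
    and "bilocale L1 L2"
    and "compact_locale TYPE('a)"
    and "prefit L1 L2 i"
  shows "bi_Baire L1 L2 i j"
  unfolding bi_Baire_def
proof (intro allI impI)
  fix \<S> :: "'a set set"
  assume \<S>: "countable \<S> \<and> (\<forall>S\<in>\<S>. bi_dense L1 L2 i S \<and> bi_open L1 L2 j S)"
  show "bi_dense L1 L2 i (\<Inter> \<S>)"
    unfolding bi_dense_iff
  proof (intro conjI ballI impI)
    show "is_sublocale (\<Inter> \<S>)"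
      using \<S> by (intro is_sublocale_Inter) (auto simp: bi_open_def)
  next
    fix b assume b: "b \<in> component L1 L2 i" "\<Inter> \<S> \<subseteq> closed_sublocale b"
    show "b = bot"
    \<comment> \<open>Only a nonempty family is enumerated by \<open>from_nat_into\<close>; the
      empty one has intersection \<open>UNIV\<close>, which contains \<open>bot\<close> and so
      forces \<open>b \<le> bot\<close>.\<close>
    proof (cases "\<S> = {}")
      case True
      then show ?thesis
        using b(2) by (force simp: closed_sublocale_def intro: bot_unique[THEN iffD1])
    next
      case False
      then have range: "range (from_nat_into \<S>) = \<S>"
        using \<S> by (simp add: range_from_nat_into)
      then have mem: "from_nat_into \<S> n \<in> \<S>" for n
        by blast
      then have "\<forall>n. \<exists>a. from_nat_into \<S> n = open_sublocale a"
        using \<S> unfolding bi_open_def by blast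
      then obtain a where a: "\<And>n. from_nat_into \<S> n = open_sublocale (a n)"
        by metis
      show ?thesis
      proof (rule prefit_eq_bot[OF assms(3,4) _ b(1)])
        show "x = bot" if "x \<in> component L1 L2 i" "inf x (a n) = bot" for n x
          using \<S> mem[of n] that
          by (auto simp: a bi_dense_iff open_sublocale_subset_closed)
        show "(\<Inter>n. open_sublocale (a n)) \<subseteq> closed_sublocale b"
          using b(2) range by (simp flip: a)
      qed
    qed
  qed
qed

end
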